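(* Consider one iteration of the 2-level MGProx method (steps (i)--(iv) in the context), with $P=c\,R(y_0^{k+1})^\top$. If $P(x_1^{k+1}-y_1^{k+1})\ne0$, then there exists $\alpha_k>0$ such that $$F_0\big(y_0^{k+1}+\alpha_kP(x_1^{k+1}-y_1^{k+1})\big)<F_0(y_0^{k+1}).$$
   Context: Problem: minimize $F_0(x)=f_0(x)+g_0(x)$ over $x\in\mathbb{R}^{n_0}$. Here $f_0:\mathbb{R}^{n_0}\to\mathbb{R}$ is $L_0$-smooth (differentiable with $L_0$-Lipschitz gradient) and $\mu_0$-strongly convex, $\mu_0>0$ (i.e. $f_0-\frac{\mu_0}{2}\|\cdot\|_2^2$ is convex); $g_0:\mathbb{R}^{n_0}\to\mathbb{R}$ is proper, convex, possibly nonsmooth and separable, $g_0(x)=\sum_i g_{0,i}(x_i)$, with a single point of nondifferentiability (each $g_{0,i}$ is nondifferentiable at at most one point). $\partial$ denotes the convex subdifferential. Coarse functions: let $n_1\le n_0$ and let $Q\in\mathbb{R}^{n_0\times n_1}$ have rank $n_1$. Put $f_1=f_0\circ Q$, $g_1=g_0\circ Q$, $F_1=f_1+g_1=F_0\circ Q:\mathbb{R}^{n_1}\to\mathbb{R}$. Adaptive restriction and prolongation: given a full restriction matrix $\overline{R}\in\mathbb{R}^{n_1\times n_0}$, for $y\in\mathbb{R}^{n_0}$ the adaptive restriction matrix $R(y)$ is obtained from $\overline{R}$ by setting to zero every column $i$ for which $\partial g_{0,i}(y_i)$ is not a singleton. Thus $R(y)\,\partial F_0(y)$ is a singleton. The associated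 prolongation is $P=c\,R(y)^\top$ with a fixed constant $c>0$. Proximal operator: $\mathrm{prox}_{\beta g}(x)=\mathrm{argmin}_u\{\beta g(u)+\frac12\|u-x\|_2^2\}$. MGProx steps: given $x_0^k$, (i) $y_0^{k+1}=\mathrm{prox}_{\frac1{L_0}g_0}\big(x_0^k-\frac1{L_0}\nabla f_0(x_0^k)\big)$; (ii) $y_1^{k+1}=R(y_0^{k+1})\,y_0^{k+1}$; (iii) choose any $\tau_{0\to1}^{k+1}\in \partial F_1(y_1^{k+1})-R(y_0^{k+1})\,\partial F_0(y_0^{k+1})$; (iv) $x_1^{k+1}=\mathrm{argmin}_{\xi\in\mathbb{R}^{n_1}}\{F_1(\xi)-\langle\tau_{0\to1}^{k+1},\xi\rangle\}$. *)

theory Defs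
  imports "HOL-Analysis.Analysis"
begin

definition subdifferential :: "('a::real_inner \<Rightarrow> real) \<Rightarrow> 'a \<Rightarrow> 'a set" where
  "subdifferential f x = {v. \<forall>y. f x + v \<bullet> (y - x) \<le> f y}"

definition grad :: "('a::real_inner \<Rightarrow> real) \<Rightarrow> 'a \<Rightarrow> 'a" where
  "grad f x = (THE d. GDERIV f x :> d)"

definition smooth_fun :: "real \<Rightarrow> ('a::real_inner \<Rightarrow> real) \<Rightarrow> bool" where
  "smooth_fun L f \<longleftrightarrow> (\<forall>x. f differentiable (at x)) \<and> L-lipschitz_on UNIV (grad f)"

definition strongly_convex :: "real \<Rightarrow> ('a::real_inner \<Rightarrow> real) \<Rightarrow> bool" where
  "strongly_convex \<mu> f \<longleftrightarrow> convex_on UNIV (\<lambda>x. f x - \<mu> / 2 * (norm x)\<^sup>2)"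

definition prox :: "real \<Rightarrow> ('a::real_inner \<Rightarrow> real) \<Rightarrow> 'a \<Rightarrow> 'a" where
  "prox \<beta> g x = (ARG_MIN (\<lambda>u. \<beta> * g u + 1 / 2 * (norm (u - x))\<^sup>2) u. True)"

text \<open>In the next two definitions, the argument \<open>h j\<close> is the \<open>j\<close>-th component of the separable
  function \<open>x \<mapsto> \<Sum>j. h j (x $ j)\<close>.\<close>

definition adaptive_restriction ::
  "('n \<Rightarrow> real \<Rightarrow> real) \<Rightarrow> real ^ 'n ^ 'm \<Rightarrow> real ^ 'n \<Rightarrow> real ^ 'n ^ 'm" where
  "adaptive_restriction h Rbar y =
     (\<chi> i j. if is_singleton (subdifferential (h j) (y $ j)) then Rbar $ i $ j else 0)"

definition prolongation ::
  "real \<Rightarrow> ('n \<Rightarrow> real \<Rightarrow> real) \<Rightarrow> real ^ 'n ^ 'm \<Rightarrow> real ^ 'n \<Rightarrow> real ^ 'm ^ 'n" where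
  "prolongation c h Rbar y = c *\<^sub>R transpose (adaptive_restriction h Rbar y)"

end

theory Submission
  imports Defs
begin

text \<open>Strong convexity of \<open>f0\<close> and injectivity of \<open>Q\<close> make the minimiser \<open>x1\<close> of the coarse
  problem unique, so the coarse objective strictly decreases from \<open>y1\<close> to \<open>x1\<close>. The definition of
  \<open>\<tau>\<close> turns this into \<open>d \<bullet> p < 0\<close> for some subgradient \<open>d\<close> of \<open>F0\<close> at \<open>y0\<close>, where
  \<open>p = P *v (x1 - y1)\<close>. In general a negative pairing with a single subgradient does not give a
  descent direction, but \<open>p\<close> is supported on the coordinates where the nonsmooth part has a single
  subgradient and hence is differentiable, so the derivative of \<open>F0\<close> along \<open>p\<close> exists and equals
  \<open>d \<bullet> p\<close>.\<close>

text \<open>By the parallelogram law the quadratic part contributes a midpoint gap of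
  \<open>\<mu> / 8 * (norm (a - b))\<^sup>2\<close>, and the convex remainder cannot undo
  it.\<close>

lemma strongly_convex_midpoint_less:
  fixes f :: "'a::real_inner \<Rightarrow> real"
  assumes "strongly_convex \<mu> f" and "\<mu> > 0" and "a \<noteq> b"
  shows "f ((1/2) *\<^sub>R a + (1/2) *\<^sub>R b) < (f a + f b) / 2"
proof -
  have "f ((1/2) *\<^sub>R a + (1/2) *\<^sub>R b) - \<mu> / 2 * (norm ((1/2) *\<^sub>R a + (1/2) *\<^sub>R b))\<^sup>2
      \<le> (1/2) * (f a - \<mu> / 2 * (norm a)\<^sup>2) + (1/2) * (f b - \<mu> / 2 * (norm b)\<^sup>2)"
    using convex_onD[OF assms(1)[unfolded strongly_convex_def], of "1/2" a b] by simp
  moreover have "(norm ((1/2) *\<^sub>R a + (1/2) *\<^sub>R b))\<^sup>2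
      = (norm a)\<^sup>2 / 2 + (norm b)\<^sup>2 / 2 - (norm (a - b))\<^sup>2 / 4"
    by (simp add: power2_norm_eq_inner inner_add_left inner_add_right inner_diff_left
        inner_diff_right inner_commute field_simps)
  moreover have "\<mu> * (norm (a - b))\<^sup>2 > 0"
    using assms by simp
  ultimately show ?thesis
    by (simp add: algebra_simps)
qed

text \<open>Along the \<open>i\<close>-th coordinate axis the other components stay frozen at 0, so
  \<open>g\<close> restricted to that axis is \<open>h i\<close> up to the constant
  \<open>C\<close>.\<close>

lemma convex_on_component_of_separable:
  fixes g :: "real ^ 'n \<Rightarrow> real"
  assumes convex: "convex_on UNIV g" and sep: "\<And>x. g x = (\<Sum>j\<in>UNIV. h j (x $ j))"
  shows "convex_on UNIV (h i)"
proof -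
  define C where "C = (\<Sum>j\<in>UNIV - {i}. h j 0)"
  have g_axis: "g (axis i s) = h i s + C" for s
  proof -
    have "g (axis i s) = h i (axis i s $ i) + (\<Sum>j\<in>UNIV - {i}. h j (axis i s $ j))"
      unfolding sep by (rule sum.remove) auto
    also have "(\<Sum>j\<in>UNIV - {i}. h j (axis i s $ j)) = C"
      unfolding C_def by (intro sum.cong) (auto simp: axis_def)
    finally show ?thesis by simp
  qed
  show ?thesis
  proof (rule convex_onI)
    fix t x y :: real
    assume t: "0 < t" "t < 1"
    have "axis i ((1 - t) *\<^sub>R x + t *\<^sub>R y) = (1 - t) *\<^sub>R axis i x + t *\<^sub>R (axis i y :: real ^ 'n)"
      by (simp add: vec_eq_iff axis_def)
    then have "h i ((1 - t) *\<^sub>R x + t *\<^sub>R y) + C \<le> (1 - t) * (h i x + C) + t * (h i y + C)"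
      using convex_onD[OF convex, of t "axis i x" "axis i y"] t by (simp flip: g_axis)
    then show "h i ((1 - t) *\<^sub>R x + t *\<^sub>R y) \<le> (1 - t) * h i x + t * h i y"
      by (simp add: algebra_simps)
  qed simp
qed

text \<open>The chord from \<open>y\<close> to \<open>z\<close> starts on the line of slope
  \<open>m\<close> and ends below it, and \<open>h\<close> lies under the chord. Since
  \<open>z\<close> may be on either side of \<open>y\<close>, this serves both one-sided estimates
  of a derivative.\<close>

lemma convex_below_line_between:
  fixes h :: "real \<Rightarrow> real"
  assumes "convex_on UNIV h" and "h z < h y + m * (z - y)"
    and u: "u \<noteq> y" "u \<in> closed_segment y z"
  shows "h u < h y + m * (u - y)"
proof -
  obtain t where t: "0 \<le> t" "t \<le> 1" "u = (1 - t) *\<^sub>R y + t *\<^sub>R z"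
    using u by (auto simp: in_segment)
  with u have "t > 0" by (cases "t = 0") auto
  have "h u \<le> (1 - t) * h y + t * h z"
    using convex_onD[OF assms(1), of t y z] t by simp
  also have "\<dots> < (1 - t) * h y + t * (h y + m * (z - y))"
    using assms(2) \<open>t > 0\<close> by simp
  also have "\<dots> = h y + m * (u - y)"
    unfolding t(3) by (simp add: algebra_simps)
  finally show ?thesis .
qed

text \<open>Neither \<open>v + e\<close> nor \<open>v - e\<close> is a subgradient, so
  \<open>h\<close> dips below each of the two corresponding lines somewhere. Convexity carries the
  dip back towards \<open>y\<close>, which traps nearby difference quotients between
  \<open>v\<close> and \<open>v + e\<close> on the right and between \<open>v - e\<close> and
  \<open>v\<close> on the left.\<close>

lemma convex_singleton_subdifferential_imp_DERIV:
  fixes h :: "real \<Rightarrow> real"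
  assumes convex: "convex_on UNIV h" and single: "subdifferential h y = {v}"
  shows "DERIV h y :> v"
  unfolding has_field_derivative_iff
proof (rule tendstoI)
  fix e :: real
  assume "e > 0"
  have v: "h y + v * (z - y) \<le> h z" for z
    using single by (auto simp: subdifferential_def)
  have "v + e \<notin> subdifferential h y" "v - e \<notin> subdifferential h y"
    using single \<open>e > 0\<close> by auto
  then obtain a b where a: "h a < h y + (v + e) * (a - y)" and b: "h b < h y + (v - e) * (b - y)"
    by (auto simp: subdifferential_def not_le)
  \<comment> \<open>Since \<open>h\<close> stays above the line of slope \<open>v\<close>, the
    steeper line can only be violated to the right of \<open>y\<close> and the flatter one only to
    the left.\<close>
  have "e * (a - y) > 0" "e * (y - b) > 0"
    using a v[of a] b v[of b] by (auto simp: algebra_simps)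
  with \<open>e > 0\<close> have "b < y" "y < a"
    by (auto simp: zero_less_mult_iff)
  have "dist ((h u - h y) / (u - y)) v < e" if "u \<noteq> y" "dist u y < min (a - y) (y - b)" for u
  proof (cases "u > y")
    case True
    with that have "u \<in> closed_segment y a"
      by (auto simp: closed_segment_eq_real_ivl dist_real_def)
    then have "h u < h y + (v + e) * (u - y)"
      using convex_below_line_between[OF convex a] that by auto
    then have "(h u - h y) / (u - y) < v + e"
      using True by (simp add: divide_simps)
    moreover have "v \<le> (h u - h y) / (u - y)"
      using v[of u] True by (simp add: divide_simps)
    ultimately show ?thesis
      by (simp add: dist_real_def)
  next
    case False
    with that have "u < y" "u \<in> closed_segment y b"
      by (auto simp: closed_segment_eq_real_ivl dist_real_def)
    then have "h u < h y + (v - e) * (u - y)"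
      using convex_below_line_between[OF convex b] that by auto
    then have "v - e < (h u - h y) / (u - y)"
      using \<open>u < y\<close> by (simp add: divide_simps)
    moreover have "(h u - h y) / (u - y) \<le> v"
      using v[of u] \<open>u < y\<close> by (simp add: divide_simps)
    ultimately show ?thesis
      by (simp add: dist_real_def)
  qed
  then show "\<forall>\<^sub>F u in at y. dist ((h u - h y) / (u - y)) v < e"
    unfolding eventually_at using \<open>b < y\<close> \<open>y < a\<close>
    by (intro exI[of _ "min (a - y) (y - b)"]) auto
qed

text \<open>Subtracting the linear term of the subgradient inequality leaves a function of \<alpha>
  with a global minimum at 0, where its derivative must vanish.\<close>

lemma DERIV_along_line_eq_subgradient:
  assumes d: "d \<in> subdifferential F y"
    and D: "DERIV (\<lambda>\<alpha>. F (y + \<alpha> *\<^sub>R p)) 0 :> D"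
  shows "D = d \<bullet> p"
proof -
  have "DERIV (\<lambda>\<alpha>. F (y + \<alpha> *\<^sub>R p) - \<alpha> * (d \<bullet> p)) 0 :> D - d \<bullet> p"
    using DERIV_diff[OF D DERIV_cmult_Id[of "d \<bullet> p" 0 UNIV]] by (simp add: mult.commute)
  moreover have "F (y + 0 *\<^sub>R p) - 0 * (d \<bullet> p) \<le> F (y + \<alpha> *\<^sub>R p) - \<alpha> * (d \<bullet> p)" for \<alpha>
    using d[unfolded subdifferential_def, simplified, rule_format, of "y + \<alpha> *\<^sub>R p"] by simp
  ultimately have "D - d \<bullet> p = 0"
    by (rule DERIV_local_min[OF _ zero_less_one, rule_format])
  then show ?thesis by simp
qed

text \<open>Adjointness of prolongation and restriction, used to carry the sign of a coarse pairing
  to the fine level.\<close>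

lemma prolongation_inner:
  "(prolongation c h Rbar y *v w) \<bullet> d = c * (w \<bullet> (adaptive_restriction h Rbar y *v d))"
  by (simp add: prolongation_def scaleR_matrix_vector_assoc[symmetric] transpose_matrix_vector
      dot_lmul_matrix)

text \<open>A column zeroed in the restriction is a zero row of its transpose.\<close>

lemma prolongation_nonzero_imp_singleton:
  assumes "(prolongation c h Rbar y *v w) $ i \<noteq> 0"
  shows "is_singleton (subdifferential (h i) (y $ i))"
  using assms
  by (cases "is_singleton (subdifferential (h i) (y $ i))")
    (simp_all add: prolongation_def adaptive_restriction_def matrix_vector_mult_def transpose_def)

text \<open>Each summand is either constant in \<alpha>, when \<open>p $ i = 0\<close>, or has a
  differentiable component at \<open>y $ i\<close>.\<close>

lemma separable_differentiable_along_line: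
  fixes g :: "real ^ 'n \<Rightarrow> real"
  assumes convex: "convex_on UNIV g" and sep: "\<And>x. g x = (\<Sum>j\<in>UNIV. h j (x $ j))"
    and single: "\<And>i. p $ i \<noteq> 0 \<Longrightarrow> is_singleton (subdifferential (h i) (y $ i))"
  shows "(\<lambda>\<alpha>. g (y + \<alpha> *\<^sub>R p)) differentiable (at 0)"
proof -
  have "(\<lambda>\<alpha>. h i (y $ i + \<alpha> * p $ i)) differentiable (at 0)" for i
  proof (cases "p $ i = 0")
    case False
    then obtain v where "subdifferential (h i) (y $ i) = {v}"
      using single by (auto simp: is_singleton_def)
    then have "DERIV (h i) (y $ i + 0 * p $ i) :> v"
      using convex_singleton_subdifferential_imp_DERIV
        convex_on_component_of_separable[OF convex sep] by simp
    moreover have "DERIV (\<lambda>\<alpha>. y $ i + \<alpha> * p $ i) 0 :> p $ i"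
      by (auto intro!: derivative_eq_intros)
    ultimately have "DERIV (\<lambda>\<alpha>. h i (y $ i + \<alpha> * p $ i)) 0 :> v * p $ i"
      by (rule DERIV_chain2)
    then show ?thesis
      by (auto simp: real_differentiable_def)
  qed simp
  then show ?thesis
    unfolding sep by simp
qed

text \<open>Minimality is tested at the midpoint of \<open>x\<close> and \<open>y\<close>, whose
  value lies strictly below the average of the two.\<close>

lemma strictly_midconvex_arg_min_less:
  fixes \<phi> :: "'a::real_vector \<Rightarrow> real"
  assumes "\<And>a b. a \<noteq> b \<Longrightarrow> \<phi> ((1/2) *\<^sub>R a + (1/2) *\<^sub>R b) < (\<phi> a + \<phi> b) / 2"
    and "is_arg_min \<phi> (\<lambda>_. True) x" and "y \<noteq> x"
  shows "\<phi> x < \<phi> y"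
proof -
  have "\<phi> x \<le> \<phi> ((1/2) *\<^sub>R x + (1/2) *\<^sub>R y)"
    using assms(2) by (auto simp: is_arg_min_def not_less)
  also have "\<dots> < (\<phi> x + \<phi> y) / 2"
    using assms(1)[of x y] assms(3) by simp
  finally show ?thesis by simp
qed

theorem lemma2p7:
  fixes f0 g0 F0 :: "real ^ 'n \<Rightarrow> real"
    and g0c :: "'n \<Rightarrow> real \<Rightarrow> real"
    and F1 :: "real ^ 'm \<Rightarrow> real"
    and Q :: "real ^ 'm ^ 'n"
    and Rbar R :: "real ^ 'n ^ 'm"
    and P :: "real ^ 'm ^ 'n"
    and L0 \<mu>0 c :: real
    and x0 y0 :: "real ^ 'n"
    and y1 \<tau> x1 :: "real ^ 'm"
  assumes "smooth_fun L0 f0"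
    and "\<mu>0 > 0" and "strongly_convex \<mu>0 f0"
    and "convex_on UNIV g0"
    and "\<And>x. g0 x = (\<Sum>i\<in>UNIV. g0c i (x $ i))"
    and "\<And>i s t. \<lbrakk>\<not> g0c i differentiable (at s); \<not> g0c i differentiable (at t)\<rbrakk> \<Longrightarrow> s = t"
    and "F0 = (\<lambda>x. f0 x + g0 x)"
    and "CARD('m) \<le> CARD('n)" and "rank Q = CARD('m)"
    and "F1 = (\<lambda>\<xi>. f0 (Q *v \<xi>) + g0 (Q *v \<xi>))"
    and "c > 0"
    and "R = adaptive_restriction g0c Rbar y0"
    and "P = prolongation c g0c Rbar y0"
    and "y0 = prox (1 / L0) g0 (x0 - (1 / L0) *\<^sub>R grad f0 x0)"
    and "y1 = R *v y0"
    and "\<tau> \<in> {s - R *v d | s d. s \<in> subdifferential F1 y1 \<and> d \<in> subdifferential F0 y0}"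
    and "is_arg_min (\<lambda>\<xi>. F1 \<xi> - \<tau> \<bullet> \<xi>) (\<lambda>_. True) x1"
    and "P *v (x1 - y1) \<noteq> 0"
  shows "\<exists>\<alpha>>0. F0 (y0 + \<alpha> *\<^sub>R (P *v (x1 - y1))) < F0 y0"
proof -
  define p where "p = P *v (x1 - y1)"
  obtain s d where s: "s \<in> subdifferential F1 y1" and d: "d \<in> subdifferential F0 y0"
    and \<tau>: "\<tau> = s - R *v d"
    using assms(16) by auto
  have "x1 \<noteq> y1"
    using assms(18) by auto

  have "inj ((*v) Q)"
    using assms(9) full_rank_injective by blast
  \<comment> \<open>Injectivity of \<open>Q\<close> keeps the images of \<open>a\<close> and
    \<open>b\<close> apart, so \<open>f0\<close> supplies the strict inequality; \<open>g0\<close>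
    adds a weak one and the \<tau> term is linear.\<close>
  have midpoint: "F1 ((1/2) *\<^sub>R a + (1/2) *\<^sub>R b) - \<tau> \<bullet> ((1/2) *\<^sub>R a + (1/2) *\<^sub>R b)
      < ((F1 a - \<tau> \<bullet> a) + (F1 b - \<tau> \<bullet> b)) / 2" if "a \<noteq> b" for a b
  proof -
    have Q: "Q *v ((1/2) *\<^sub>R a + (1/2) *\<^sub>R b) = (1/2) *\<^sub>R (Q *v a) + (1/2) *\<^sub>R (Q *v b)"
      by (simp add: matrix_vector_right_distrib matrix_vector_mult_scaleR)
    have "Q *v a \<noteq> Q *v b"
      using \<open>inj ((*v) Q)\<close> that by (auto dest: injD)
    then have "f0 ((1/2) *\<^sub>R (Q *v a) + (1/2) *\<^sub>R (Q *v b)) < (f0 (Q *v a) + f0 (Q *v b)) / 2"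
      using strongly_convex_midpoint_less assms(2,3) by blast
    moreover have "g0 ((1/2) *\<^sub>R (Q *v a) + (1/2) *\<^sub>R (Q *v b)) \<le> (g0 (Q *v a) + g0 (Q *v b)) / 2"
      using convex_onD[OF assms(4), of "1/2" "Q *v a" "Q *v b"] by simp
    ultimately show ?thesis
      unfolding assms(10) Q by (simp add: inner_add_right field_simps)
  qed
  have "F1 x1 - \<tau> \<bullet> x1 < F1 y1 - \<tau> \<bullet> y1"
    using strictly_midconvex_arg_min_less[OF midpoint assms(17)] \<open>x1 \<noteq> y1\<close> by auto
  \<comment> \<open>This cancels the \<open>s\<close> part of \<tau> in the strict decrease, so only
    the pairing with \<open>R *v d\<close> remains.\<close>
  moreover have "F1 y1 + s \<bullet> (x1 - y1) \<le> F1 x1"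
    using s by (auto simp: subdifferential_def)
  ultimately have "(x1 - y1) \<bullet> (R *v d) < 0"
    unfolding \<tau> by (simp add: inner_diff_left inner_diff_right inner_commute)
  then have "p \<bullet> d < 0"
    unfolding p_def assms(12,13) prolongation_inner using assms(11) by (simp add: mult_pos_neg)

  have "(\<lambda>\<alpha>. g0 (y0 + \<alpha> *\<^sub>R p)) differentiable (at 0)"
    using separable_differentiable_along_line[OF assms(4,5)] prolongation_nonzero_imp_singleton
    unfolding p_def assms(13) by blast
  moreover have "(\<lambda>\<alpha>. f0 (y0 + \<alpha> *\<^sub>R p)) differentiable (at (0::real))"
  proof (rule differentiable_compose[of f0])
    show "f0 differentiable (at (y0 + 0 *\<^sub>R p))"
      using assms(1) by (simp add: smooth_fun_def)
    show "(\<lambda>\<alpha>. y0 + \<alpha> *\<^sub>R p) differentiable (at (0::real))"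
      by (intro derivative_intros)
  qed
  ultimately have "(\<lambda>\<alpha>. F0 (y0 + \<alpha> *\<^sub>R p)) differentiable (at 0)"
    unfolding assms(7) by (rule differentiable_add[rotated])
  then obtain D where D: "DERIV (\<lambda>\<alpha>. F0 (y0 + \<alpha> *\<^sub>R p)) 0 :> D"
    by (auto simp: real_differentiable_def)
  \<comment> \<open>The directional derivative is the pairing of \<open>p\<close> with the very
    subgradient \<open>d\<close> that enters \<tau>.\<close>
  have "D < 0"
    using DERIV_along_line_eq_subgradient[OF d D] \<open>p \<bullet> d < 0\<close> by (simp add: inner_commute)
  then obtain \<delta> where "\<delta> > 0" "\<And>h. 0 < h \<Longrightarrow> h < \<delta> \<Longrightarrow> F0 (y0 + h *\<^sub>R p) < F0 y0"
    using DERIV_neg_dec_right[OF D] by auto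
  then show ?thesis
    unfolding p_def by (intro exI[of _ "\<delta> / 2"]) auto
qed

end
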